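(* Let $m$ and $t$ be positive integers. There exists a $3$-SCHGDD of type $(3,m^t)$ (equivalently, a $(3,mt;m)$-CHDM) if and only if $(t-1)m\equiv 0\pmod 2$ and $t\geq 3$, with the exception that none exists when $m\equiv 0\pmod 2$ and $t=3$.
   Context: Let $I_n=\{0,1,\ldots,n-1\}$ and let $Z_v$ be the integers modulo $v$. Let $S=\{0,t,2t,\ldots,(m-1)t\}$ be the subgroup of order $m$ of $Z_{mt}$. A $3$-SCHGDD of type $(n,m^t)$ (semi-cyclic holey group divisible design) is a family $\mathcal{B}^*$ of $3$-element subsets (base blocks) of $I_n\times Z_{mt}$ with the following property. For $i,j\in I_n$, define the multiset $\Delta_{ij}(\mathcal{B}^* )=\bigcup_{B\in\mathcal{B}^*}\{x-y \pmod{mt} : (i,x),(j,y)\in B,\ (i,x)\neq(j,y)\}$. It is required that $\Delta_{ij}(\mathcal{B}^* )$ equals $Z_{mt}\setminus S$ (each element exactly once) whenever $i\neq j$, and that $\Delta_{ii}(\mathcal{B}^* )=\emptyset$ for all $i$. A $(k,wt;w)$-CHDM (cyclic holey difference matrix) is a $k\times w(t-1)$ matrix $D=(d_{ij})$ with entries in $Z_{wt}$ such that for any two distinct rows $x,y$ the list $\{d_{xj}-d_{yj}: 0\le j\le w(t-1)-1\}$ contains each element of $Z_{wt}\setminus\{0,t,\ldots,(w-1)t\}$ exactly once.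
   Formalization: Designs are required to be nonempty (at least one base block, at least one matrix column); this matters only for t = 1, where the hole is all of Z_m and the empty family would otherwise be a 3-SCHGDD, contradicting the claim that t ≥ 3 is necessary. *)

theory Defs
  imports
    "HOL-Library.Multiset"
    "HOL-Number_Theory.Cong"
    "Jordan_Normal_Form.Matrix"
begin

text \<open>The group of integers modulo \<open>v\<close> is represented by its least nonnegative residues;
  differences of residues are always reduced with \<open>mod\<close>.\<close>

definition Zmod :: "nat \<Rightarrow> int set" where
  "Zmod v = {0..<int v}"

text \<open>The hole \<open>{0, t, 2t, \<dots>, (m-1)t}\<close>, the subgroup of order \<open>m\<close> of the integers modulo \<open>mt\<close>.\<close>

definition hole_subgroup :: "nat \<Rightarrow> nat \<Rightarrow> int set" where
  "hole_subgroup m t = (\<lambda>a. int (a * t)) ` {..<m}"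

definition block_diffs :: "nat \<Rightarrow> nat \<Rightarrow> nat \<Rightarrow> (nat \<times> int) set \<Rightarrow> int multiset" where
  "block_diffs v i j B =
     image_mset (\<lambda>(p, q). (snd p - snd q) mod int v)
       (mset_set {(p, q). p \<in> B \<and> q \<in> B \<and> fst p = i \<and> fst q = j \<and> p \<noteq> q})"

text \<open>Families of base blocks are multisets of blocks, so repeated base blocks are not excluded
  a priori, and multiplicities of differences are added up over the family.\<close>

definition family_diffs :: "nat \<Rightarrow> nat \<Rightarrow> nat \<Rightarrow> (nat \<times> int) set multiset \<Rightarrow> int multiset" where
  "family_diffs v i j \<B> = (\<Sum>B\<in>#\<B>. block_diffs v i j B)"

text \<open>A \<open>k\<close>-SCHGDD of type \<open>(n, m\<^sup>t)\<close>, given by its family of base blocks. Designs are understood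
  to be nonempty. This only matters for \<open>t = 1\<close>, where the hole is the whole group and the empty
  family would satisfy the conditions on differences vacuously (for \<open>m > 0\<close>, \<open>t > 1\<close> and
  \<open>n > 1\<close> the conditions on differences already force a nonempty family).\<close>

definition is_SCHGDD :: "nat \<Rightarrow> nat \<Rightarrow> nat \<Rightarrow> nat \<Rightarrow> (nat \<times> int) set multiset \<Rightarrow> bool" where
  "is_SCHGDD k n m t \<B> \<longleftrightarrow>
     \<B> \<noteq> {#} \<and>
     (\<forall>B\<in>#\<B>. B \<subseteq> {..<n} \<times> Zmod (m * t) \<and> card B = k) \<and>
     (\<forall>i<n. \<forall>j<n. i \<noteq> j \<longrightarrow>
        family_diffs (m * t) i j \<B> = mset_set (Zmod (m * t) - hole_subgroup m t)) \<and>
     (\<forall>i<n. family_diffs (m * t) i i \<B> = {#})"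

text \<open>A \<open>(k, wt; w)\<close>-CHDM. As for SCHGDDs, the degenerate object is excluded: the matrix has at
  least one column, which for \<open>w > 0\<close> is a restriction only when \<open>t = 1\<close>.\<close>

definition is_CHDM :: "nat \<Rightarrow> nat \<Rightarrow> nat \<Rightarrow> int mat \<Rightarrow> bool" where
  "is_CHDM k w t D \<longleftrightarrow>
     D \<in> carrier_mat k (w * (t - 1)) \<and> dim_col D > 0 \<and>
     elements_mat D \<subseteq> Zmod (w * t) \<and>
     (\<forall>x<k. \<forall>y<k. x \<noteq> y \<longrightarrow>
        (\<forall>d \<in> Zmod (w * t) - hole_subgroup w t.
           count (mset (map (\<lambda>j. (D $$ (x, j) - D $$ (y, j)) mod int (w * t))
                         [0..<w * (t - 1)])) d = 1))"

end

theory Submission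
  imports Defs
begin

text \<open>Normalising the first row (or the point in group 0) to zero, both objects amount to a
  permutation \<open>f\<close> of the elements of the cyclic group outside the hole such that \<open>x \<mapsto> f x - x\<close>
  permutes them as well.

  Necessity compares sums: the elements outside the hole have sum \<open>mt \<cdot> m(t-1)/2\<close>, which must
  vanish modulo \<open>mt\<close>. For \<open>t = 3\<close> such an \<open>f\<close> interchanges the classes 1 and 2 modulo 3, and
  the same comparison on class 1 alone forces \<open>m\<close> to be odd. For \<open>t = 2\<close>, differences of odd
  numbers are even.

  Sufficiency: if \<open>mt\<close> is odd then \<open>f x = 2x\<close> works. If \<open>m = 2n\<close>, write \<open>x = r + ti\<close> and
  \<open>f x - x = c + ti\<close>, where the representative \<open>c\<close> of a nonzero class modulo \<open>t\<close> depends on \<open>r\<close> and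
  on whether \<open>i < n\<close>. Then \<open>f x = (r + c) + 2ti\<close>, and on each half of the range of \<open>i\<close> the term
  \<open>2ti\<close> runs once through the multiples of \<open>2t\<close>; so it is enough that the \<open>2(t-1)\<close> sums \<open>r + c\<close>
  are the residues modulo \<open>2t\<close> that are not multiples of \<open>t\<close>. This no longer involves \<open>n\<close>, and it is
  solved by two explicit permutations of \<open>{1..t-1}\<close> when \<open>t \<ge> 4\<close>.\<close>

section \<open>Holey orthomorphisms\<close>

text \<open>The hole is described by divisibility: since \<open>t\<close> divides
  \<open>m * t\<close>, membership of a residue can be tested on any representative, before
  reduction.\<close>

definition nonhole :: "nat \<Rightarrow> nat \<Rightarrow> int set" where
  "nonhole m t = {x \<in> {0..<int (m * t)}. \<not> int t dvd x}"

text \<open>An orthomorphism of the cyclic group of order \<open>m * t\<close>, with the hole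
  removed from the domain and from both ranges.\<close>

definition holey_orthomorphism :: "nat \<Rightarrow> nat \<Rightarrow> (int \<Rightarrow> int) \<Rightarrow> bool" where
  "holey_orthomorphism m t f \<longleftrightarrow>
     bij_betw f (nonhole m t) (nonhole m t) \<and>
     bij_betw (\<lambda>x. (f x - x) mod int (m * t)) (nonhole m t) (nonhole m t)"

section \<open>Residues outside the hole\<close>

lemma finite_nonhole [simp]: "finite (nonhole m t)"
  by (rule finite_subset[of _ "{0..<int (m * t)}"]) (auto simp: nonhole_def)

lemma hole_subgroup_eq:
  assumes "t > 0"
  shows "hole_subgroup m t = {x \<in> {0..<int (m * t)}. int t dvd x}"
proof (intro equalityI subsetI)
  fix x assume "x \<in> hole_subgroup m t"
  then show "x \<in> {x \<in> {0..<int (m * t)}. int t dvd x}"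
    using assms by (auto simp: hole_subgroup_def simp flip: of_nat_mult)
next
  fix x assume x: "x \<in> {x \<in> {0..<int (m * t)}. int t dvd x}"
  then obtain k where k: "x = int t * k" by auto
  with x assms have "0 \<le> k" by (auto simp: zero_le_mult_iff)
  moreover have "k < int m"
  proof (rule ccontr)
    assume "\<not> k < int m"
    then have "int t * int m \<le> int t * k" by (intro mult_left_mono) auto
    with x k show False by (simp add: mult.commute)
  qed
  ultimately show "x \<in> hole_subgroup m t"
    using k by (auto simp: hole_subgroup_def image_iff mult.commute intro!: bexI[of _ "nat k"])
qed

lemma Zmod_minus_hole: "t > 0 \<Longrightarrow> Zmod (m * t) - hole_subgroup m t = nonhole m t"
  by (auto simp: hole_subgroup_eq Zmod_def nonhole_def)

lemma card_nonhole:
  assumes "t > 0"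
  shows "card (nonhole m t) = m * (t - 1)"
proof -
  have "card (hole_subgroup m t) = m"
    unfolding hole_subgroup_def using assms by (subst card_image) (auto simp: inj_on_def)
  moreover have "hole_subgroup m t \<subseteq> Zmod (m * t)"
    using hole_subgroup_eq[OF assms] by (auto simp: Zmod_def)
  ultimately have "card (nonhole m t) = m * t - m"
    using Zmod_minus_hole[OF assms, of m] card_Diff_subset[of "hole_subgroup m t" "Zmod (m * t)"]
    by (simp add: hole_subgroup_def Zmod_def del: of_nat_mult)
  then show ?thesis by (simp add: diff_mult_distrib2)
qed

lemma mod_in_nonhole_iff:
  assumes "m > 0" "t > 0"
  shows "x mod int (m * t) \<in> nonhole m t \<longleftrightarrow> \<not> int t dvd x"
  using assms by (auto simp: nonhole_def dvd_mod_iff)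

lemma bij_betw_uminus_nonhole:
  assumes "m > 0" "t > 0"
  shows "bij_betw (\<lambda>x. (- x) mod int (m * t)) (nonhole m t) (nonhole m t)"
proof (rule bij_betw_byWitness[where f' = "\<lambda>x. (- x) mod int (m * t)"])
  show "\<forall>x\<in>nonhole m t. (- ((- x) mod int (m * t))) mod int (m * t) = x"
    by (auto simp: mod_minus_eq nonhole_def)
  then show "\<forall>x\<in>nonhole m t. (- ((- x) mod int (m * t))) mod int (m * t) = x" .
  show "(\<lambda>x. (- x) mod int (m * t)) ` nonhole m t \<subseteq> nonhole m t"
    by (rule image_subsetI) (subst mod_in_nonhole_iff[OF assms], simp add: nonhole_def)
  then show "(\<lambda>x. (- x) mod int (m * t)) ` nonhole m t \<subseteq> nonhole m t" .
qed

text \<open>Take \<open>f\<close> to be \<open>y\<close> after the inverse of \<open>x\<close>. The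
  index set \<open>K\<close> is arbitrary, so that blocks, columns or pairs of coordinates can serve
  as parameters.\<close>

lemma holey_orthomorphism_of_bijections:
  assumes x: "bij_betw x K (nonhole m t)" and y: "bij_betw y K (nonhole m t)"
    and z: "bij_betw (\<lambda>k. (y k - x k) mod int (m * t)) K (nonhole m t)"
  shows "\<exists>f. holey_orthomorphism m t f"
proof -
  have i: "bij_betw (inv_into K x) (nonhole m t) K" by (rule bij_betw_inv_into[OF x])
  have "bij_betw (y \<circ> inv_into K x) (nonhole m t) (nonhole m t)"
    using bij_betw_trans[OF i y] .
  moreover have "bij_betw (\<lambda>a. ((y \<circ> inv_into K x) a - a) mod int (m * t)) (nonhole m t) (nonhole m t)"
  proof (rule iffD1[OF bij_betw_cong bij_betw_trans[OF i z]])
    show "((\<lambda>k. (y k - x k) mod int (m * t)) \<circ> inv_into K x) a =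
        ((y \<circ> inv_into K x) a - a) mod int (m * t)" if "a \<in> nonhole m t" for a
      using bij_betw_inv_into_right[OF x that] by simp
  qed
  ultimately have "holey_orthomorphism m t (y \<circ> inv_into K x)"
    unfolding holey_orthomorphism_def ..
  then show ?thesis by blast
qed

text \<open>\<open>M\<close> has size \<open>card A\<close>, so its support has at most that many
  elements; a map from the support onto \<open>A\<close> is then injective.\<close>

lemma bij_betw_of_image_mset:
  assumes "image_mset f M = mset_set A" "finite A"
  shows "bij_betw f (set_mset M) A"
proof -
  have im: "f ` set_mset M = A"
    using assms by (metis finite_set_mset_mset_set set_image_mset)
  have "card (set_mset M) \<le> size M"
    by (metis mset_set_set_mset_msubset size_mset_mono size_mset_set)
  also have "size M = card A"
    using assms by (metis size_image_mset size_mset_set)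
  finally have "inj_on f (set_mset M)"
    using im card_image_le[of "set_mset M" f] by (intro eq_card_imp_inj_on) auto
  with im show ?thesis by (simp add: bij_betw_def)
qed

text \<open>Common to blocks and matrix columns: \<open>p c i\<close> is the entry of
  \<open>c\<close> in row \<open>i\<close>. Subtracting row 0 leaves the difference of rows 2 and 1
  unchanged, and the new rows 1 and 2 are the graph of \<open>f\<close>.\<close>

lemma holey_orthomorphism_of_differences:
  fixes p :: "'c \<Rightarrow> nat \<Rightarrow> int"
  assumes "\<And>i j. i < 3 \<Longrightarrow> j < 3 \<Longrightarrow> i \<noteq> j \<Longrightarrow>
      image_mset (\<lambda>c. (p c i - p c j) mod int (m * t)) M = mset_set (nonhole m t)"
  shows "\<exists>f. holey_orthomorphism m t f"
proof -
  have *: "bij_betw (\<lambda>c. (p c i - p c j) mod int (m * t)) (set_mset M) (nonhole m t)"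
    if "i < 3" "j < 3" "i \<noteq> j" for i j :: nat
    using bij_betw_of_image_mset[OF assms[OF that]] by simp
  have "bij_betw (\<lambda>c. ((p c 2 - p c 0) mod int (m * t) - (p c 1 - p c 0) mod int (m * t)) mod int (m * t))
      (set_mset M) (nonhole m t)"
    using *[of 2 1] by (simp add: mod_diff_eq)
  then show ?thesis
    by (rule holey_orthomorphism_of_bijections[OF *[of 1 0] *[of 2 0], rotated -1]) auto
qed

definition column :: "(int \<Rightarrow> int) \<Rightarrow> int \<Rightarrow> nat \<Rightarrow> int" where
  "column f x i = (if i = 0 then 0 else if i = 1 then x else f x)"

text \<open>The six ordered pairs of rows give \<open>x\<close>, \<open>f x\<close>,
  \<open>f x - x\<close> and their negatives, and negation permutes the residues outside the
  hole.\<close>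

lemma bij_betw_column_diff:
  assumes "holey_orthomorphism m t f" "m > 0" "t > 0" "i < 3" "j < 3" "i \<noteq> j"
  shows "bij_betw (\<lambda>x. (column f x i - column f x j) mod int (m * t)) (nonhole m t) (nonhole m t)"
proof -
  let ?N = "nonhole m t" and ?v = "int (m * t)"
  have f: "bij_betw f ?N ?N" and g: "bij_betw (\<lambda>x. (f x - x) mod ?v) ?N ?N"
    using assms(1) by (auto simp: holey_orthomorphism_def)
  have neg: "bij_betw (\<lambda>x. (- h x) mod ?v) ?N ?N" if "bij_betw h ?N ?N" for h
    using bij_betw_trans[OF that bij_betw_uminus_nonhole[OF assms(2,3)]] by (simp add: comp_def)
  have fN: "f x \<in> ?N" if "x \<in> ?N" for x using f that by (auto simp: bij_betw_def)
  have md: "x mod ?v = x" if "x \<in> ?N" for x using that by (auto simp: nonhole_def)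
  have f': "bij_betw (\<lambda>x. f x mod ?v) ?N ?N"
    using f bij_betw_cong[of ?N f "\<lambda>x. f x mod ?v" ?N] fN md by auto
  have x': "bij_betw (\<lambda>x. x mod ?v) ?N ?N"
    using bij_betw_id[of ?N] bij_betw_cong[of ?N id "\<lambda>x. x mod ?v" ?N] md by auto
  consider "i = 0 \<and> j = 1" | "i = 0 \<and> j = 2" | "i = 1 \<and> j = 0" | "i = 1 \<and> j = 2" | "i = 2 \<and> j = 0" | "i = 2 \<and> j = 1"
    using assms(4-6) by linarith
  then show ?thesis
  proof cases
    case 4
    then show ?thesis using neg[OF g] by (simp add: column_def mod_minus_eq)
  qed (use f' x' g neg[OF f] neg[OF bij_betw_id[of ?N]] in \<open>auto simp: column_def\<close>)
qed

section \<open>Semi-cyclic holey group divisible designs\<close>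

definition transversal :: "nat \<Rightarrow> (nat \<Rightarrow> int) \<Rightarrow> (nat \<times> int) set" where
  "transversal k p = (\<lambda>i. (i, p i)) ` {..<k}"

lemma block_diffs_transversal:
  assumes "i < k" "j < k"
  shows "block_diffs v i j (transversal k p) = (if i = j then {#} else {#(p i - p j) mod int v#})"
proof -
  have "{(a, b). a \<in> transversal k p \<and> b \<in> transversal k p \<and> fst a = i \<and> fst b = j \<and> a \<noteq> b} =
      (if i = j then {} else {((i, p i), (j, p j))})"
    using assms by (auto simp: transversal_def)
  then show ?thesis by (simp add: block_diffs_def)
qed

text \<open>Two points in one group would produce a difference within that group. Hence the
  \<open>k\<close> points lie in distinct groups, and so meet all \<open>k\<close> of them.\<close>

lemma transversal_of_block:
  assumes B: "B \<subseteq> {..<k} \<times> Z" "card B = k" and "k > 0"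
    and empty: "\<And>i. i < k \<Longrightarrow> block_diffs v i i B = {#}"
  shows "\<exists>p. B = transversal k p"
proof -
  have "finite B" using assms by (metis card.infinite less_not_refl)
  have "inj_on fst B"
  proof (rule inj_onI, rule ccontr)
    fix a b assume ab: "a \<in> B" "b \<in> B" "fst a = fst b" "a \<noteq> b"
    let ?P = "{(p, q). p \<in> B \<and> q \<in> B \<and> fst p = fst a \<and> fst q = fst a \<and> p \<noteq> q}"
    have "finite ?P" by (rule finite_subset[of _ "B \<times> B"]) (use \<open>finite B\<close> in auto)
    moreover have "(a, b) \<in> ?P" using ab by auto
    moreover have "fst a < k" using ab B by auto
    then have "mset_set ?P = {#}" using empty[of "fst a"] by (simp add: block_diffs_def)
    ultimately show False by (metis (no_types, lifting) empty_iff mset_set_empty_iff)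
  qed
  then have "card (fst ` B) = k" using B by (simp add: card_image)
  moreover have "fst ` B \<subseteq> {..<k}" using B by auto
  ultimately have fst: "fst ` B = {..<k}" by (intro card_subset_eq) auto
  define p where "p = snd \<circ> inv_into B fst"
  have "(i, p i) \<in> B" if "i < k" for i
  proof -
    have "i \<in> fst ` B" using that fst by auto
    then have "inv_into B fst i \<in> B" "fst (inv_into B fst i) = i"
      by (auto intro: inv_into_into f_inv_into_f)
    then show ?thesis by (metis comp_apply p_def prod.collapse)
  qed
  then have "transversal k p \<subseteq> B" by (auto simp: transversal_def)
  moreover have "card (transversal k p) = card B"
    using B by (simp add: transversal_def card_image inj_on_def)
  ultimately show ?thesis using \<open>finite B\<close> by (metis card_subset_eq)
qed

lemma holey_orthomorphism_of_SCHGDD: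
  assumes D: "is_SCHGDD 3 3 m t \<B>" and "m > 0" "t > 0"
  shows "t \<ge> 2 \<and> (\<exists>f. holey_orthomorphism m t f)"
proof -
  let ?v = "m * t"
  have ne: "\<B> \<noteq> {#}"
    and blk: "\<And>B. B \<in># \<B> \<Longrightarrow> B \<subseteq> {..<3} \<times> Zmod ?v \<and> card B = 3"
    and off: "\<And>i j. i < 3 \<Longrightarrow> j < 3 \<Longrightarrow> i \<noteq> j \<Longrightarrow> family_diffs ?v i j \<B> = mset_set (nonhole m t)"
    and diag: "\<And>i. i < 3 \<Longrightarrow> family_diffs ?v i i \<B> = {#}"
    using D Zmod_minus_hole[OF \<open>t > 0\<close>] by (auto simp: is_SCHGDD_def)
  have "\<exists>p. B = transversal 3 p" if "B \<in># \<B>" for B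
  proof (rule transversal_of_block)
    show "block_diffs ?v i i B = {#}" if "i < 3" for i
      using diag[OF that] \<open>B \<in># \<B>\<close> by (auto simp: family_diffs_def)
  qed (use blk[OF that] in auto)
  then obtain p where p: "\<And>B. B \<in># \<B> \<Longrightarrow> B = transversal 3 (p B)" by metis
  have diffs: "image_mset (\<lambda>B. (p B i - p B j) mod int ?v) \<B> = mset_set (nonhole m t)"
    if ij: "i < 3" "j < 3" "i \<noteq> j" for i j
  proof -
    have "block_diffs ?v i j B = {#(p B i - p B j) mod int ?v#}" if "B \<in># \<B>" for B
      using block_diffs_transversal[OF ij(1,2), of ?v "p B"] p[OF that] ij(3) by simp
    then have "family_diffs ?v i j \<B> = (\<Sum>B\<in>#\<B>. {#(p B i - p B j) mod int ?v#})"
      unfolding family_diffs_def by (metis (no_types, lifting) image_mset_cong)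
    then show ?thesis using off[OF ij] by (simp add: sum_mset_singleton_mset)
  qed
  \<comment> \<open>A block contributes a difference outside the hole; for \<open>t = 1\<close>
    there is no such residue.\<close>
  have "nonhole m t \<noteq> {}" using diffs[of 1 0] ne by auto
  then have "m * (t - 1) > 0"
    using card_nonhole[OF \<open>t > 0\<close>, of m] card_gt_0_iff[of "nonhole m t"] by simp
  then have "t \<ge> 2" by simp
  moreover have "\<exists>f. holey_orthomorphism m t f"
    by (rule holey_orthomorphism_of_differences) (rule diffs)
  ultimately show ?thesis ..
qed

lemma SCHGDD_of_holey_orthomorphism:
  assumes f: "holey_orthomorphism m t f" and mt: "m > 0" "t \<ge> 2"
  shows "\<exists>\<B>. is_SCHGDD 3 3 m t \<B>"
proof -
  let ?v = "m * t" and ?N = "nonhole m t"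
  define \<B> where "\<B> = image_mset (\<lambda>x. transversal 3 (column f x)) (mset_set ?N)"
  have t: "t > 0" using mt by simp
  have diffs: "family_diffs ?v i j \<B> = (if i = j then {#} else mset_set ?N)" if ij: "i < 3" "j < 3" for i j
  proof -
    have "family_diffs ?v i j \<B> =
        (\<Sum>x\<in>#mset_set ?N. if i = j then {#} else {#(column f x i - column f x j) mod int ?v#})"
      unfolding family_diffs_def \<B>_def
      by (simp add: image_mset.compositionality comp_def block_diffs_transversal[OF ij])
    also have "\<dots> = (if i = j then {#} else mset_set ?N)"
      using bij_betw_column_diff[OF f mt(1) t ij]
      by (auto simp: sum_mset_singleton_mset image_mset_mset_set bij_betw_def)
    finally show ?thesis .
  qed
  have "B \<subseteq> {..<3} \<times> Zmod ?v \<and> card B = 3" if B: "B \<in># \<B>" for B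
  proof -
    obtain x where x: "x \<in> ?N" "B = transversal 3 (column f x)" using B by (auto simp: \<B>_def)
    have "f x \<in> ?N" using f x by (auto simp: holey_orthomorphism_def bij_betw_def)
    then show ?thesis
      using x mt by (auto simp: transversal_def column_def Zmod_def nonhole_def card_image inj_on_def)
  qed
  moreover have "\<B> \<noteq> {#}"
    using card_nonhole[OF t, of m] mt by (auto simp: \<B>_def mset_set_empty_iff)
  ultimately have "is_SCHGDD 3 3 m t \<B>"
    using diffs by (auto simp: is_SCHGDD_def Zmod_minus_hole[OF t])
  then show ?thesis ..
qed

section \<open>Cyclic holey difference matrices\<close>

lemma holey_orthomorphism_of_CHDM:
  assumes D: "is_CHDM 3 m t D" and "m > 0" "t > 0"
  shows "t \<ge> 2 \<and> (\<exists>f. holey_orthomorphism m t f)"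
proof -
  let ?n = "m * (t - 1)"
  have "image_mset (\<lambda>c. (D $$ (i, c) - D $$ (j, c)) mod int (m * t)) (mset_set {0..<?n}) = mset_set (nonhole m t)"
    (is "?Q = _") if ij: "i < 3" "j < 3" "i \<noteq> j" for i j
  \<comment> \<open>The definition prescribes multiplicities only outside the hole. There are
    exactly as many columns as residues outside it, so no column is left for a difference in the
    hole.\<close>
  proof (rule sym, rule ccontr)
    have "count ?Q d = 1" if "d \<in> nonhole m t" for d
      using D ij that \<open>t > 0\<close> by (auto simp: is_CHDM_def Zmod_minus_hole simp flip: mset_upt)
    then have "mset_set (nonhole m t) \<subseteq># ?Q"
      by (auto simp: subseteq_mset_def count_mset_set')
    moreover assume "mset_set (nonhole m t) \<noteq> ?Q"
    ultimately have "size (mset_set (nonhole m t)) < size ?Q"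
      by (intro mset_subset_size) (simp add: subset_mset.less_le)
    then show False using card_nonhole[OF \<open>t > 0\<close>, of m] by simp
  qed
  then have "\<exists>f. holey_orthomorphism m t f"
    by (intro holey_orthomorphism_of_differences[where p = "\<lambda>c i. D $$ (i, c)"])
  moreover have "?n > 0" using D by (auto simp: is_CHDM_def)
  then have "t \<ge> 2" by (cases t) auto
  ultimately show ?thesis by blast
qed

lemma CHDM_of_holey_orthomorphism:
  assumes f: "holey_orthomorphism m t f" and mt: "m > 0" "t \<ge> 2"
  shows "\<exists>D. is_CHDM 3 m t D"
proof -
  let ?n = "m * (t - 1)" and ?N = "nonhole m t"
  have t: "t > 0" using mt by simp
  obtain e where e: "bij_betw e {0..<?n} ?N"
    using ex_bij_betw_nat_finite[of ?N] card_nonhole[OF t, of m] by auto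
  define D where "D = mat 3 ?n (\<lambda>(i, c). column f (e c) i)"
  have "count (mset (map (\<lambda>c. (D $$ (i, c) - D $$ (j, c)) mod int (m * t)) [0..<?n])) d = 1"
    if ij: "i < 3" "j < 3" "i \<noteq> j" and d: "d \<in> ?N" for i j d
  proof -
    let ?g = "\<lambda>x. (column f x i - column f x j) mod int (m * t)"
    have eq: "map (\<lambda>c. (D $$ (i, c) - D $$ (j, c)) mod int (m * t)) [0..<?n] = map (?g \<circ> e) [0..<?n]"
      using ij by (auto simp: D_def)
    have "bij_betw (?g \<circ> e) {0..<?n} ?N"
      using bij_betw_trans[OF e bij_betw_column_diff[OF f mt(1) t ij]] .
    then have "mset (map (?g \<circ> e) [0..<?n]) = mset_set ?N"
      by (simp only: mset_map mset_upt image_mset_mset_set bij_betw_def)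
    then show ?thesis unfolding eq using d by simp
  qed
  moreover have "elements_mat D \<subseteq> Zmod (m * t)"
  proof
    fix a assume "a \<in> elements_mat D"
    then obtain i c where c: "c < ?n" "a = column f (e c) i" by (auto simp: elements_mat_def D_def)
    then have "e c \<in> ?N" using e by (auto simp: bij_betw_def)
    moreover from this have "f (e c) \<in> ?N" using f by (auto simp: holey_orthomorphism_def bij_betw_def)
    ultimately show "a \<in> Zmod (m * t)" using c mt by (auto simp: column_def Zmod_def nonhole_def)
  qed
  ultimately have "is_CHDM 3 m t D"
    using mt by (auto simp: is_CHDM_def D_def Zmod_minus_hole[OF t])
  then show ?thesis ..
qed

section \<open>Necessary conditions\<close>

lemma even_card_of_holey_orthomorphism:
  assumes f: "holey_orthomorphism m t f" and mt: "m > 0" "t > 0"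
  shows "even ((t - 1) * m)"
proof -
  let ?N = "nonhole m t" and ?v = "int (m * t)"
  \<comment> \<open>Negation replaces \<open>x\<close> by \<open>?v - x\<close>, which evaluates
    twice the sum.\<close>
  have "(\<Sum>x\<in>?N. x) = (\<Sum>x\<in>?N. (- x) mod ?v)"
    using sum.reindex_bij_betw[OF bij_betw_uminus_nonhole[OF mt], of id] by simp
  also have "\<dots> = (\<Sum>x\<in>?N. ?v - x)"
  proof (rule sum.cong)
    fix x assume "x \<in> ?N"
    then have "0 < x" "x < ?v" by (cases "x = 0"; auto simp: nonhole_def)+
    then show "(- x) mod ?v = ?v - x" by (simp add: zmod_zminus1_eq_if)
  qed simp
  also have "\<dots> = int (card ?N) * ?v - (\<Sum>x\<in>?N. x)" by (simp add: sum_subtractf)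
  finally have s: "2 * (\<Sum>x\<in>?N. x) = int (card ?N) * ?v" by simp
  \<comment> \<open>With \<open>S\<close> the sum over \<open>?N\<close>, both \<open>f x\<close>
    and the reduced differences sum to \<open>S\<close>; the total is
    \<open>S - S - S = - S\<close>.\<close>
  have "?v dvd (\<Sum>x\<in>?N. (f x - x) - (f x - x) mod ?v)" by (rule dvd_sum) simp
  also have "\<dots> = - (\<Sum>x\<in>?N. x)"
    using f sum.reindex_bij_betw[of f ?N ?N id]
      sum.reindex_bij_betw[of "\<lambda>x. (f x - x) mod ?v" ?N ?N id]
    by (simp add: holey_orthomorphism_def sum_subtractf)
  finally obtain k where k: "(\<Sum>x\<in>?N. x) = ?v * k" by (auto elim: dvdE)
  have "int (card ?N) * ?v = (2 * k) * ?v"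
    unfolding s[symmetric] k by (simp only: mult_ac)
  then have "int (card ?N) = 2 * k" using mt by (simp only: mult_cancel_right) auto
  then have "even (card ?N)" by presburger
  then show ?thesis using card_nonhole[OF mt(2), of m] by (simp add: mult.commute)
qed

lemma no_holey_orthomorphism_2:
  assumes f: "holey_orthomorphism m 2 f" and "m > 0"
  shows False
proof -
  let ?N = "nonhole m 2" and ?v = "int (m * 2)"
  have "1 \<in> ?N" using assms by (auto simp: nonhole_def)
  then have "f 1 \<in> ?N" "(f 1 - 1) mod ?v \<in> ?N"
    using f by (auto simp: holey_orthomorphism_def bij_betw_def)
  then have "odd (f 1)" "odd (f 1 - 1)" using mod_in_nonhole_iff[of m 2] \<open>m > 0\<close> by (auto simp: nonhole_def)
  then show False by simp
qed

lemma odd_of_holey_orthomorphism_3: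
  assumes f: "holey_orthomorphism m 3 f" and m: "m > 0"
  shows "odd m"
proof -
  let ?N = "nonhole m 3" and ?v = "int (m * 3)"
  define g where "g x = (f x - x) mod ?v" for x
  define A where "A = {x \<in> ?N. x mod 3 = 1}"
  define B where "B = {x \<in> ?N. x mod 3 = 2}"
  have inj: "inj_on f ?N" "inj_on g ?N" and N: "\<And>x. x \<in> ?N \<Longrightarrow> f x \<in> ?N" "\<And>x. x \<in> ?N \<Longrightarrow> g x \<in> ?N"
    using f by (auto simp: holey_orthomorphism_def bij_betw_def g_def[abs_def])
  \<comment> \<open>Neither \<open>f x\<close> nor \<open>f x - 1\<close> is 0 modulo 3, so
    \<open>f x\<close> can only be 2 modulo 3.\<close>
  have cls: "f x mod 3 = 2 \<and> g x mod 3 = 1" if x: "x \<in> A" for x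
  proof -
    have "\<not> 3 dvd f x" "\<not> 3 dvd f x - x"
      using x N[of x] mod_in_nonhole_iff[OF m, of 3 "f x - x"] by (auto simp: nonhole_def A_def g_def)
    moreover have "g x mod 3 = (f x - x) mod 3" by (simp add: g_def mod_mod_cancel)
    moreover have "x mod 3 = 1" using x by (simp add: A_def)
    ultimately show ?thesis by presburger
  qed
  have fin: "finite A" "finite B" by (auto simp: A_def B_def)
  \<comment> \<open>The shift by 1 shows that \<open>A\<close> and \<open>B\<close> have equal size
    and expresses the sum over \<open>B\<close> through \<open>A\<close>.\<close>
  have succ: "bij_betw (\<lambda>x. x + 1) A B"
  proof (rule bij_betw_byWitness[where f' = "\<lambda>x. x - 1"])
    show "(\<lambda>x. x + 1) ` A \<subseteq> B" "(\<lambda>x. x - 1) ` B \<subseteq> A"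
      by (auto simp: A_def B_def nonhole_def; presburger)+
  qed auto
  have fAB: "bij_betw f A B"
  proof -
    have "inj_on f A" using inj by (auto simp: A_def intro: inj_on_subset)
    moreover have "f ` A \<subseteq> B" using cls N by (auto simp: A_def B_def)
    ultimately show ?thesis using fin bij_betw_same_card[OF succ]
      by (simp add: bij_betw_def card_image card_subset_eq)
  qed
  have gAA: "bij_betw g A A"
  proof -
    have "inj_on g A" using inj by (auto simp: A_def intro: inj_on_subset)
    moreover have "g ` A \<subseteq> A" using cls N by (auto simp: A_def)
    ultimately show ?thesis using fin by (simp add: bij_betw_def endo_inj_surj)
  qed
  have sf: "(\<Sum>x\<in>A. f x) = (\<Sum>x\<in>A. x + 1)"
    using sum.reindex_bij_betw[OF fAB, of id] sum.reindex_bij_betw[OF succ, of id] by simp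
  have sg: "(\<Sum>x\<in>A. g x) = (\<Sum>x\<in>A. x)"
    using sum.reindex_bij_betw[OF gAA, of id] by simp
  \<comment> \<open>Summed over \<open>A\<close>, the terms become \<open>(x + 1) - x - x\<close>.
    Writing \<open>x = 3 * a + 1\<close> turns the divisibility by \<open>3 * m\<close> into one of
    \<open>m * (m - 1) / 2\<close> by \<open>m\<close>.\<close>
  have "?v dvd (\<Sum>x\<in>A. (f x - x) - g x)" unfolding g_def by (rule dvd_sum) simp
  also have "\<dots> = - (\<Sum>x\<in>A. x - 1)" using sf sg by (simp add: sum_subtractf sum.distrib)
  also have "(\<Sum>x\<in>A. x - 1) = 3 * (\<Sum>a<m. int a)"
  proof -
    have "bij_betw (\<lambda>a. 3 * int a + 1) {..<m} A"
    proof (rule bij_betw_byWitness[where f' = "\<lambda>x. nat (x div 3)"])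
      show "(\<lambda>a. 3 * int a + 1) ` {..<m} \<subseteq> A" by (auto simp: A_def nonhole_def; presburger)
      show "(\<lambda>x. nat (x div 3)) ` A \<subseteq> {..<m}" by (auto simp: A_def nonhole_def)
      show "\<forall>x\<in>A. 3 * int (nat (x div 3)) + 1 = x"
        by (auto simp: A_def nonhole_def) presburger
    qed auto
    from sum.reindex_bij_betw[OF this, of "\<lambda>x. x - 1"] show ?thesis by (simp add: sum_distrib_left)
  qed
  finally obtain k where "3 * (\<Sum>a<m. int a) = ?v * k" by (auto elim: dvdE)
  then have "2 * (\<Sum>a<m. int a) = int m * (2 * k)" by simp
  moreover have "2 * (\<Sum>a<m. int a) = int m * (int m - 1)"
    by (induction m) (auto simp: algebra_simps)
  ultimately have "int m - 1 = 2 * k" using m by simp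
  then show ?thesis by presburger
qed

section \<open>Constructions\<close>

lemma holey_orthomorphism_double:
  assumes "odd (m * t)"
  shows "holey_orthomorphism m t (\<lambda>x. (2 * x) mod int (m * t))"
proof -
  let ?N = "nonhole m t" and ?v = "int (m * t)"
  have pos: "m > 0" "t > 0" using assms by (auto intro: Nat.gr0I)
  \<comment> \<open>As 2 is a unit modulo \<open>m * t\<close>, doubling is injective; as it is a
    unit modulo \<open>t\<close>, doubling avoids the hole.\<close>
  have v: "coprime ?v 2" and t: "coprime (int t) 2" using assms by auto
  have "inj_on (\<lambda>x. (2 * x) mod ?v) ?N"
  proof (rule inj_onI)
    fix x y assume xy: "x \<in> ?N" "y \<in> ?N" "(2 * x) mod ?v = (2 * y) mod ?v"
    then have "?v dvd 2 * (x - y)" by (simp add: mod_eq_dvd_iff right_diff_distrib)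
    then have "?v dvd x - y" using coprime_dvd_mult_right_iff[OF v] by blast
    then have "x mod ?v = y mod ?v" by (simp add: mod_eq_dvd_iff)
    then show "x = y" using xy by (auto simp: nonhole_def)
  qed
  moreover have "(\<lambda>x. (2 * x) mod ?v) ` ?N \<subseteq> ?N"
  proof (rule image_subsetI)
    fix x assume "x \<in> ?N"
    then have "\<not> int t dvd 2 * x" using t by (simp add: nonhole_def coprime_dvd_mult_right_iff)
    then show "(2 * x) mod ?v \<in> ?N" using mod_in_nonhole_iff[OF pos] by blast
  qed
  ultimately have "bij_betw (\<lambda>x. (2 * x) mod ?v) ?N ?N"
    by (simp add: bij_betw_def endo_inj_surj)
  moreover have "bij_betw (\<lambda>x. ((2 * x) mod ?v - x) mod ?v) ?N ?N"
  proof (rule iffD1[OF bij_betw_cong bij_betw_id])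
    show "id x = ((2 * x) mod ?v - x) mod ?v" if "x \<in> ?N" for x
      using that by (simp add: nonhole_def mod_simps)
  qed
  ultimately show ?thesis by (simp add: holey_orthomorphism_def)
qed

section \<open>Even \<open>m\<close>: reduction to sums modulo \<open>2 * t\<close>\<close>

text \<open>The representatives are \<open>1, \<dots>, t-1\<close>, except that the class of \<open>h\<close> is represented by \<open>h + t\<close>:
  with \<open>1, \<dots>, t-1\<close> alone, the sums \<open>\<plusminus>1\<close> modulo \<open>2t\<close> would never occur.\<close>

definition lift_rep :: "int \<Rightarrow> int \<Rightarrow> int \<Rightarrow> int" where
  "lift_rep t h c = (if c = h then c + t else c)"

text \<open>The boolean selects the half of the range of \<open>i\<close>: \<open>True\<close>
  stands for \<open>i < n\<close>.\<close>

definition half_sum :: "int \<Rightarrow> int \<Rightarrow> (bool \<Rightarrow> int \<Rightarrow> int) \<Rightarrow> bool \<times> int \<Rightarrow> int" where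
  "half_sum t h \<sigma> = (\<lambda>(b, r). r + lift_rep t h (\<sigma> b r))"

text \<open>The interval \<open>{2..2 * t + 1}\<close> is a complete residue system modulo
  \<open>2 * t\<close>, so sums that differ as integers are also incongruent.\<close>

definition half_scheme :: "int \<Rightarrow> int \<Rightarrow> (bool \<Rightarrow> int \<Rightarrow> int) \<Rightarrow> bool" where
  "half_scheme t h \<sigma> \<longleftrightarrow>
     (\<forall>b. \<forall>r\<in>{1..<t}. \<sigma> b r \<in> {1..<t} \<and> half_sum t h \<sigma> (b, r) \<in> {2..2 * t + 1} \<and>
        \<not> t dvd half_sum t h \<sigma> (b, r)) \<and>
     (\<forall>b. inj_on (\<sigma> b) {1..<t}) \<and>
     inj_on (half_sum t h \<sigma>) (UNIV \<times> {1..<t})"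

lemma eq_of_dvd_diff_small:
  fixes a b d :: int
  assumes "d dvd a - b" "\<bar>a - b\<bar> < d"
  shows "a = b"
  using assms dvd_imp_le_int[of "a - b" d] by (cases "a = b") auto

lemma holey_orthomorphism_of_half_scheme:
  assumes S: "half_scheme (int t) h \<sigma>" and n: "n > 0" and t: "t > 0"
  shows "\<exists>f. holey_orthomorphism (2 * n) t f"
proof -
  let ?t = "int t" and ?n = "int n" and ?v = "int (2 * n * t)" and ?N = "nonhole (2 * n) t"
  \<comment> \<open>A pair \<open>(r, i)\<close> stands for the element \<open>r + t * i\<close>;
    \<open>w\<close> is the prescribed difference and \<open>y\<close> the resulting value of
    \<open>f\<close>.\<close>
  define K where "K = {1..<?t} \<times> {0..<2 * ?n}"
  define x where "x = (\<lambda>(r, i). r + ?t * i)"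
  define w where "w = (\<lambda>(r, i). lift_rep ?t h (\<sigma> (i < ?n) r) + ?t * i)"
  define y where "y k = (x k + w k) mod ?v" for k
  have sig: "\<sigma> b r \<in> {1..<?t}" if "r \<in> {1..<?t}" for b r
    using S that unfolding half_scheme_def by blast
  have sig_inj: "r = s" if "r \<in> {1..<?t}" "s \<in> {1..<?t}" "\<sigma> b r = \<sigma> b s" for b r s
    using S that unfolding half_scheme_def inj_on_def by blast
  have tv: "?t dvd ?v" "2 * ?t dvd ?v" by auto
  have finK: "finite K" by (simp add: K_def)
  \<comment> \<open>With equal cardinalities, each of the three maps only has to be injective and
    avoid the hole.\<close>
  have card: "card K = card ?N"
    using card_nonhole[OF t, of "2 * n"] t by (simp add: K_def nat_diff_distrib nat_mult_distrib mult.commute)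
  have bij: "bij_betw g K ?N" if "inj_on g K" "g ` K \<subseteq> ?N" for g
    using that card card_image[of g K] by (simp add: bij_betw_def card_subset_eq)
  have pos: "2 * n > 0" using n by simp
  have cancel: "i = j" if "?v dvd ?t * (i - j)" "i \<in> {0..<2 * ?n}" "j \<in> {0..<2 * ?n}" for i j
  proof (rule eq_of_dvd_diff_small)
    have "?t * (2 * ?n) dvd ?t * (i - j)" using that(1) by (simp add: mult_ac)
    then show "2 * ?n dvd i - j" using t by simp
  qed (use that in auto)
  have x: "bij_betw x K ?N"
  proof (rule bij)
    show "inj_on x K"
    proof (rule inj_onI, clarify)
      fix r i s j assume K: "(r, i) \<in> K" "(s, j) \<in> K" and eq: "x (r, i) = x (s, j)"
      have "r - s = ?t * (j - i)" using eq by (simp add: x_def algebra_simps)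
      then have "r = s" using K by (intro eq_of_dvd_diff_small[of ?t]) (auto simp: K_def)
      then show "r = s \<and> i = j" using eq t by (simp add: x_def)
    qed
    show "x ` K \<subseteq> ?N"
    proof (rule image_subsetI, clarify)
      fix r i assume K: "(r, i) \<in> K"
      then have "?t * i \<le> ?t * (2 * ?n - 1)" by (intro mult_left_mono) (auto simp: K_def)
      then have "x (r, i) < ?v" using K by (simp add: x_def K_def algebra_simps)
      moreover have "\<not> ?t dvd r" using K by (auto simp: K_def dest: zdvd_imp_le)
      ultimately show "x (r, i) \<in> ?N" using K by (auto simp: nonhole_def x_def K_def dvd_add_left_iff)
    qed
  qed
  have w: "bij_betw (\<lambda>k. w k mod ?v) K ?N"
  proof (rule bij)
    have *: "\<not> ?t dvd w (r, i)" "?t dvd w (r, i) - \<sigma> (i < ?n) r" if "(r, i) \<in> K" for r i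
    proof -
      have "\<not> ?t dvd \<sigma> (i < ?n) r" using sig[of r "i < ?n"] that by (auto simp: K_def dest: zdvd_imp_le)
      then show "\<not> ?t dvd w (r, i)" by (auto simp: w_def lift_rep_def dvd_add_left_iff)
      show "?t dvd w (r, i) - \<sigma> (i < ?n) r" by (auto simp: w_def lift_rep_def)
    qed
    show "inj_on (\<lambda>k. w k mod ?v) K"
    proof (rule inj_onI, clarify)
      fix r i s j assume K: "(r, i) \<in> K" "(s, j) \<in> K" and eq: "w (r, i) mod ?v = w (s, j) mod ?v"
      have d: "?v dvd w (r, i) - w (s, j)" using eq by (simp add: mod_eq_dvd_iff)
      have "?t dvd (w (r, i) - w (s, j)) - (w (r, i) - \<sigma> (i < ?n) r) + (w (s, j) - \<sigma> (j < ?n) s)"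
        by (rule dvd_add[OF dvd_diff[OF dvd_trans[OF tv(1) d] *(2)[OF K(1)]] *(2)[OF K(2)]])
      then have "?t dvd \<sigma> (i < ?n) r - \<sigma> (j < ?n) s" by simp
      then have \<sigma>: "\<sigma> (i < ?n) r = \<sigma> (j < ?n) s"
        using sig[of r "i < ?n"] sig[of s "j < ?n"] K by (intro eq_of_dvd_diff_small[of ?t]) (auto simp: K_def)
      \<comment> \<open>The representative depends only on the value of \<open>\<sigma>\<close>, so
        it cancels even when \<open>i\<close> and \<open>j\<close> lie in different halves. Once
        \<open>i = j\<close>, injectivity of a single \<open>\<sigma> b\<close> suffices.\<close>
      then have "w (r, i) - w (s, j) = ?t * (i - j)" by (simp add: w_def algebra_simps)
      then have "i = j" using d K by (intro cancel) (auto simp: K_def)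
      then show "r = s \<and> i = j" using sig_inj[of r s "i < ?n"] \<sigma> K by (auto simp: K_def)
    qed
    show "(\<lambda>k. w k mod ?v) ` K \<subseteq> ?N"
      using *(1) mod_in_nonhole_iff[OF pos t] by (intro image_subsetI) (metis surj_pair)
  qed
  have xw: "x (r, i) + w (r, i) = half_sum ?t h \<sigma> (i < ?n, r) + 2 * ?t * i" for r i
    by (simp add: x_def w_def half_sum_def)
  have hs: "half_sum ?t h \<sigma> (b, r) \<in> {2..2 * ?t + 1}" "\<not> ?t dvd half_sum ?t h \<sigma> (b, r)"
    if "r \<in> {1..<?t}" for b r
    using S that unfolding half_scheme_def by blast+
  have y: "bij_betw y K ?N"
  proof (rule bij)
    show "inj_on y K"
    proof (rule inj_onI, clarify)
      fix r i s j assume K: "(r, i) \<in> K" "(s, j) \<in> K" and eq: "y (r, i) = y (s, j)"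
      have rs: "r \<in> {1..<?t}" "s \<in> {1..<?t}" using K by (auto simp: K_def)
      have "?v dvd (half_sum ?t h \<sigma> (i < ?n, r) + 2 * ?t * i) - (half_sum ?t h \<sigma> (j < ?n, s) + 2 * ?t * j)"
        using eq unfolding y_def xw by (simp only: mod_eq_dvd_iff)
      then have d: "?v dvd (half_sum ?t h \<sigma> (i < ?n, r) - half_sum ?t h \<sigma> (j < ?n, s)) + 2 * ?t * (i - j)"
        by (simp only: algebra_simps)
      \<comment> \<open>Modulo \<open>2 * t\<close> only the half sums remain, and they determine
        both the half and \<open>r\<close>. Within one half \<open>i\<close> and \<open>j\<close>
        differ by less than \<open>n\<close>, while the full congruence makes \<open>n\<close>
        divide \<open>i - j\<close>.\<close>
      then have "2 * ?t dvd half_sum ?t h \<sigma> (i < ?n, r) - half_sum ?t h \<sigma> (j < ?n, s)"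
        using dvd_trans[OF tv(2) d] by (simp only: dvd_add_left_iff dvd_triv_left)
      then have h: "half_sum ?t h \<sigma> (i < ?n, r) = half_sum ?t h \<sigma> (j < ?n, s)"
        using hs(1)[OF rs(1), of "i < ?n"] hs(1)[OF rs(2), of "j < ?n"]
        by (intro eq_of_dvd_diff_small[of "2 * ?t"]) auto
      then have b: "(i < ?n) = (j < ?n) \<and> r = s"
        using S rs unfolding half_scheme_def inj_on_def by blast
      have "(2 * ?t) * ?n dvd (2 * ?t) * (i - j)" using d h by (simp add: mult_ac)
      then have "?n dvd i - j" using t by simp
      moreover have "\<bar>i - j\<bar> < ?n" using b K by (auto simp: K_def)
      ultimately show "r = s \<and> i = j" using b eq_of_dvd_diff_small by blast
    qed
    show "y ` K \<subseteq> ?N"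
    proof (rule image_subsetI, clarify)
      fix r i assume K: "(r, i) \<in> K"
      have "\<not> ?t dvd half_sum ?t h \<sigma> (i < ?n, r) + 2 * ?t * i"
        using hs(2)[of r "i < ?n"] K by (simp add: K_def dvd_add_left_iff)
      then show "y (r, i) \<in> ?N" unfolding y_def xw using mod_in_nonhole_iff[OF pos t] by blast
    qed
  qed
  have "(y k - x k) mod ?v = w k mod ?v" for k by (simp add: y_def mod_diff_left_eq)
  then show ?thesis using holey_orthomorphism_of_bijections[OF x y] w by simp
qed

text \<open>\<open>ret b\<close> inverts \<open>\<sigma> b\<close>, and \<open>dec\<close> recovers
  half and class from the sum. For \<open>t \<ge> 2\<close> the only multiples of \<open>t\<close>
  in the interval are \<open>t\<close> and \<open>2 * t\<close>.\<close>

lemma half_schemeI: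
  assumes "t \<ge> 2"
    and range: "\<And>b r. r \<in> {1..<t} \<Longrightarrow> \<sigma> b r \<in> {1..<t}"
    and ret: "\<And>b r. r \<in> {1..<t} \<Longrightarrow> ret b (\<sigma> b r) = r"
    and dec: "\<And>b r. r \<in> {1..<t} \<Longrightarrow> dec (r + lift_rep t h (\<sigma> b r)) = (b, 2 * r)"
    and sum: "\<And>b r. r \<in> {1..<t} \<Longrightarrow> r + lift_rep t h (\<sigma> b r) \<in> {2..2 * t + 1} - {t, 2 * t}"
  shows "half_scheme t h \<sigma>"
proof -
  have "\<not> t dvd s" if s: "s \<in> {2..2 * t + 1} - {t, 2 * t}" for s
  proof
    assume "t dvd s"
    then obtain k where k: "s = t * k" ..
    have "0 < t * k" using s k by auto
    then have "0 < k" using \<open>t \<ge> 2\<close> by (simp add: zero_less_mult_iff)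
    moreover have "k < 3"
    proof (rule ccontr)
      assume "\<not> k < 3"
      then have "t * 3 \<le> t * k" using \<open>t \<ge> 2\<close> by (intro mult_left_mono) auto
      moreover have "t * k \<le> 2 * t + 1" using s k by auto
      ultimately show False using \<open>t \<ge> 2\<close> by linarith
    qed
    ultimately have "k = 1 \<or> k = 2" by linarith
    then show False using s k by auto
  qed
  moreover have "inj_on (\<sigma> b) {1..<t}" for b
    by (rule inj_on_inverseI[of _ "ret b"]) (rule ret)
  moreover have "inj_on (half_sum t h \<sigma>) (UNIV \<times> {1..<t})"
    by (rule inj_on_inverseI[of _ "\<lambda>s. (fst (dec s), snd (dec s) div 2)"]) (auto simp: half_sum_def dec)
  ultimately show ?thesis using range sum unfolding half_scheme_def half_sum_def by simp
qed

text \<open>The explicit permutations are piecewise in the position of \<open>a\<close> relative to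
  \<open>h\<close> and the parity of \<open>a - h\<close>; the witness \<open>j\<close> turns parity
  into linear equations.\<close>

lemma around_cases:
  fixes a h :: int
  obtains "a < h" | "a = h" | "a = h + 1" | j where "j \<ge> 1" "a = h + 2*j" | j where "j \<ge> 1" "a = h + 2*j + 1"
proof (cases "even (a - h)")
  case True then obtain j where j: "a - h = 2*j" by blast
  consider "j < 0" | "j = 0" | "j \<ge> 1" by linarith
  then show ?thesis by cases (use j that(1,2) that(4)[of j] in auto)
next
  case False then obtain j where j: "a - h = 2*j + 1" using oddE by blast
  consider "j < 0" | "j = 0" | "j \<ge> 1" by linarith
  then show ?thesis by cases (use j that(1,3) that(5)[of j] in auto)
qed

section \<open>Half schemes for even \<open>t\<close>\<close>

text \<open>The case \<open>t = 2h\<close>. The values near the ends of the pieces are corrections found by computer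
  search. Injectivity is shown by exhibiting left inverses; to avoid division, the decoder
  \<open>even_dec\<close> returns \<open>2 * r\<close> in place of \<open>r\<close>.\<close>

definition even_fst :: "int \<Rightarrow> int \<Rightarrow> int" where
  "even_fst h a = (if a \<le> 2*h-3 then a+1 else if a = 2*h-2 then 1 else a)"

text \<open>On \<open>h, ..., 2*h-1\<close> this is one cycle: up in steps of two along the even
  offsets from \<open>h\<close>, across at the top, down along the odd offsets. Its sums are even
  except \<open>4*h-3\<close> and \<open>4*h+1\<close>; those of \<open>even_fst\<close> are odd
  except \<open>4*h-2\<close>.\<close>

definition even_snd :: "int \<Rightarrow> int \<Rightarrow> int" where
  "even_snd h a = (if a < h then a else if a = h+1 then h else if odd (a-h) then a-2
     else if a \<ge> 2*h-2 then 4*h-3-a else a+2)"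

text \<open>After the exceptional sums, parity gives the half. The test modulo 4 separates
  \<open>s = 2*a-2\<close> with \<open>a-h\<close> odd from \<open>s = 2*a+2\<close> with
  \<open>a-h\<close> even.\<close>

definition even_dec :: "int \<Rightarrow> int \<Rightarrow> bool \<times> int" where
  "even_dec h s = (if s = 4*h-2 then (True, 4*h-2) else if s = 2*h-1 then (True, 4*h-4)
     else if s = 4*h-1 then (True, 2*h-2) else if s = 4*h+1 then (False, 2*h+2)
     else if s = 4*h-3 then (False, if odd h then 4*h-2 else 4*h-4)
     else if odd s then (True, s-1) else if s < 2*h then (False, s)
     else if 4 dvd s - 2*h then (False, s+2) else (False, s-2))"

lemma even_dec_snd:
  assumes "h \<ge> 2" "1 \<le> a" "a < 2*h"
  shows "even_dec h (a + lift_rep (2*h) h (even_snd h a)) = (False, 2*a)"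
  by (cases rule: around_cases[of a h])
    (use assms in \<open>auto simp: even_snd_def even_dec_def lift_rep_def split: if_splits; presburger\<close>)+

lemma even_dec_fst:
  assumes "h \<ge> 2" "1 \<le> a" "a < 2*h"
  shows "even_dec h (a + lift_rep (2*h) h (even_fst h a)) = (True, 2*a)"
  by (cases rule: around_cases[of a h])
    (use assms in \<open>auto simp: even_fst_def even_dec_def lift_rep_def split: if_splits; presburger\<close>)+

definition even_ret :: "int \<Rightarrow> bool \<Rightarrow> int \<Rightarrow> int" where
  "even_ret h b c = (if b
     then if c = 1 then 2*h-2 else if c = 2*h-1 then c else c-1
     else if c < h then c else if c = h then h+1 else if even (c-h) then c-2
     else if c \<ge> 2*h-2 then 4*h-3-c else c+2)"

lemma even_ret_fst:
  assumes "h \<ge> 2" "1 \<le> a" "a < 2*h"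
  shows "even_ret h True (even_fst h a) = a"
  using assms unfolding even_fst_def even_ret_def by (auto split: if_splits)

lemma even_ret_snd:
  assumes "h \<ge> 2" "1 \<le> a" "a < 2*h"
  shows "even_ret h False (even_snd h a) = a"
  by (cases rule: around_cases[of a h])
    (use assms in \<open>auto simp: even_snd_def even_ret_def split: if_splits; presburger\<close>)+

lemma even_fst_range:
  assumes "h \<ge> 2" "1 \<le> a" "a < 2*h"
  shows "1 \<le> even_fst h a" "even_fst h a < 2*h"
    "a + lift_rep (2*h) h (even_fst h a) \<in> {2..2*(2*h)+1} - {2*h, 2*(2*h)}"
  using assms by (auto simp: even_fst_def lift_rep_def split: if_splits; presburger)+

lemma even_snd_range:
  assumes "h \<ge> 2" "1 \<le> a" "a < 2*h"
  shows "1 \<le> even_snd h a" "even_snd h a < 2*h"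
    "a + lift_rep (2*h) h (even_snd h a) \<in> {2..2*(2*h)+1} - {2*h, 2*(2*h)}"
  by (cases rule: around_cases[of a h];
      use assms in \<open>auto simp: even_snd_def lift_rep_def split: if_splits; presburger\<close>)+

lemma half_scheme_even:
  assumes h: "h \<ge> 2"
  shows "half_scheme (2*h) h (\<lambda>b. if b then even_fst h else even_snd h)"
proof (rule half_schemeI[where dec = "even_dec h" and ret = "even_ret h"])
  fix b r assume "r \<in> {1..<2*h}"
  then have r: "1 \<le> r" "r < 2*h" by auto
  show "(if b then even_fst h else even_snd h) r \<in> {1..<2*h}"
    using even_fst_range[OF h r] even_snd_range[OF h r] by (cases b) auto
  show "r + lift_rep (2*h) h ((if b then even_fst h else even_snd h) r) \<in> {2..2*(2*h)+1} - {2*h, 2*(2*h)}"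
    using even_fst_range(3)[OF h r] even_snd_range(3)[OF h r] by (cases b) auto
  show "even_dec h (r + lift_rep (2*h) h ((if b then even_fst h else even_snd h) r)) = (b, 2*r)"
    using even_dec_fst[OF h r] even_dec_snd[OF h r] by (cases b) auto
  show "even_ret h b ((if b then even_fst h else even_snd h) r) = r"
    using even_ret_fst[OF h r] even_ret_snd[OF h r] by (cases b) auto
qed (use h in simp)

section \<open>Half schemes for odd \<open>t\<close>\<close>

text \<open>The case \<open>t = 2h + 1\<close>, for \<open>h \<ge> 4\<close>; \<open>t = 5\<close> and \<open>t = 7\<close> are too small for this pattern.\<close>

definition odd_fst :: "int \<Rightarrow> int \<Rightarrow> int" where
  "odd_fst h a = (if a < h \<or> a = h+1 \<or> a = 2*h then a else if a = h then h+3
     else if even (a-h) then (if a = 2*h-1 then a else a-2)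
     else if a \<ge> 2*h-2 then a-1 else a+2)"

text \<open>The sums are odd except \<open>2*h\<close>, \<open>2*h+4\<close> and one of
  \<open>4*h-2\<close> (\<open>h\<close> even) or \<open>4*h-4\<close> (\<open>h\<close> odd). Those
  of \<open>odd_fst\<close> are even except \<open>2*h+3\<close>, \<open>4*h+3\<close> and one of
  \<open>4*h-3\<close> (\<open>h\<close> even) or \<open>4*h-5\<close> (\<open>h\<close>
  odd).\<close>

definition odd_snd :: "int \<Rightarrow> int \<Rightarrow> int" where
  "odd_snd h a = (if a < h-1 then a+1 else if a = h-1 then h+1 else if a = h then h
     else if a = h+1 then h+3 else if a = 2*h-2 then 1
     else if even (a-h) then (if a \<ge> 2*h-1 then a-2 else a+3)
     else if a = 2*h-1 then a+1 else a-1)"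

definition odd_dec :: "int \<Rightarrow> int \<Rightarrow> bool \<times> int" where
  "odd_dec h s = (if s \<le> 2*h
     then if s = 2*h-1 then (False, 4*h-4) else if s = 2*h then (False, 2*h-2)
       else if even s then (True, s) else (False, s-1)
     else if even s
     then if s = 2*h+2 then (True, s) else if s = 2*h+4 then (False, s-2)
       else if s = 4*h then (True, s)
       else if s = 4*h-2 then if odd h then (True, s) else (False, s+2)
       else if s = 4*h-4 \<and> odd h then (False, s+2)
       else (True, if 4 dvd s-2*h then s-2 else s+2)
     else if s = 2*h+3 then (True, s-3) else if s = 4*h+1 then (False, 2*h)
       else if s = 4*h+3 then (True, 2*h+4)
       else if s = 4*h-1 then (False, if odd h then s+1 else s-1)
       else if s = 4*h-3 \<and> even h \<or> s = 4*h-5 \<and> odd h then (True, s+1)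
       else (False, if 4 dvd s-2*h-3 then s-3 else s+1))"

text \<open>One of four generic patterns on the upper range: the bounds and the parity of
  \<open>a - h\<close> exclude every exceptional sum and fix the residue modulo 4 that selects the
  last branch.\<close>

lemma odd_dec_even_minus:
  assumes "h \<ge> 4" "a = h + 2*j" "j \<ge> 2" "a \<le> 2*h-2"
  shows "odd_dec h (2*a-2) = (True, 2*a)"
proof -
  have "\<not> 2*a-2 \<le> 2*h" "2*a-2 \<noteq> 2*h+2" "2*a-2 \<noteq> 2*h+4" "2*a-2 \<noteq> 4*h" "2*a-2 \<noteq> 4*h-2" "2*a-2 \<noteq> 4*h-4"
    using assms by presburger+
  moreover have "\<not> 4 dvd 2*a-2-2*h" using assms by presburger
  ultimately show ?thesis by (simp add: odd_dec_def)
qed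

lemma odd_dec_odd_plus:
  assumes "h \<ge> 4" "a = h + 2*j + 1" "j \<ge> 1" "a \<le> 2*h-3"
  shows "odd_dec h (2*a+2) = (True, 2*a)"
proof -
  have "\<not> 2*a+2 \<le> 2*h" "2*a+2 \<noteq> 2*h+2" "2*a+2 \<noteq> 2*h+4" "2*a+2 \<noteq> 4*h" "2*a+2 \<noteq> 4*h-2" "2*a+2 = 4*h-4 \<longrightarrow> even h"
    using assms by presburger+
  moreover have "4 dvd 2*a+2-2*h" using assms by presburger
  ultimately show ?thesis by (simp add: odd_dec_def)
qed

lemma odd_dec_even_plus:
  assumes "h \<ge> 4" "a = h + 2*j" "j \<ge> 1" "a \<le> 2*h-3"
  shows "odd_dec h (2*a+3) = (False, 2*a)"
proof -
  have "\<not> 2*a+3 \<le> 2*h" "2*a+3 \<noteq> 2*h+3" "2*a+3 \<noteq> 4*h+1" "2*a+3 \<noteq> 4*h+3" "2*a+3 \<noteq> 4*h-1"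
     "2*a+3 = 4*h-3 \<longrightarrow> odd h" "2*a+3 = 4*h-5 \<longrightarrow> even h"
    using assms by presburger+
  moreover have "4 dvd 2*a+3-2*h-3" using assms by presburger
  ultimately show ?thesis by (simp add: odd_dec_def)
qed

lemma odd_dec_odd_minus:
  assumes "h \<ge> 4" "a = h + 2*j+1" "j \<ge> 1" "a \<le> 2*h-3"
  shows "odd_dec h (2*a-1) = (False, 2*a)"
proof -
  have "\<not> 2*a-1 \<le> 2*h" "2*a-1 \<noteq> 2*h+3" "2*a-1 \<noteq> 4*h+1" "2*a-1 \<noteq> 4*h+3" "2*a-1 \<noteq> 4*h-1"
     "2*a-1 \<noteq> 4*h-3" "2*a-1 \<noteq> 4*h-5 \<or> even h"
    using assms by presburger+
  moreover have "\<not> 4 dvd 2*a-1-2*h-3" using assms by presburger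
  ultimately show ?thesis by (simp add: odd_dec_def)
qed

lemma odd_dec_fst_even:
  assumes "h \<ge> 4" "a = h + 2*j" "j \<ge> 1" "a \<le> 2*h"
  shows "odd_dec h (a + lift_rep (2*h+1) h (odd_fst h a)) = (True, 2*a)"
proof -
  consider "j = 1" | "a = 2*h" | "a = 2*h-1" | "j \<ge> 2" "a \<le> 2*h-2" using assms by linarith
  then show ?thesis
  proof cases
    \<comment> \<open>Here \<open>a = h + 2\<close> is sent to \<open>h\<close>, whose
      representative is shifted by \<open>t\<close>, so the sum is \<open>4*h+3\<close>.\<close>
    case 1 with assms show ?thesis by (simp add: odd_dec_def odd_fst_def lift_rep_def)
  next
    case 2 with assms show ?thesis by (simp add: odd_dec_def odd_fst_def lift_rep_def)
  next
    case 3 then have "odd h" using assms by presburger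
    with 3 assms(1) show ?thesis by (auto simp: odd_dec_def odd_fst_def lift_rep_def)
  next
    case 4
    then have "odd_fst h a = a - 2" "lift_rep (2*h+1) h (a-2) = a-2" using assms by (auto simp: odd_fst_def lift_rep_def)
    moreover have "a + (a - 2) = 2*a - 2" by simp
    ultimately show ?thesis using odd_dec_even_minus[of h a j] 4 assms by metis
  qed
qed

lemma odd_dec_fst_odd:
  assumes "h \<ge> 4" "a = h + 2*j+1" "j \<ge> 1" "a \<le> 2*h"
  shows "odd_dec h (a + lift_rep (2*h+1) h (odd_fst h a)) = (True, 2*a)"
proof -
  consider "a = 2*h" | "a = 2*h-1" | "a = 2*h-2" | "a \<le> 2*h-3" using assms by linarith
  then show ?thesis
  proof cases
    case 1 with assms show ?thesis by (simp add: odd_dec_def odd_fst_def lift_rep_def)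
  next
    case 2 then have "even h" using assms by presburger
    with 2 assms(1) show ?thesis by (simp add: odd_dec_def odd_fst_def lift_rep_def)
  next
    case 3 then have "odd h" using assms by presburger
    with 3 assms(1) show ?thesis by (auto simp: odd_dec_def odd_fst_def lift_rep_def)
  next
    case 4
    then have "odd_fst h a = a + 2" "lift_rep (2*h+1) h (a+2) = a+2" using assms by (auto simp: odd_fst_def lift_rep_def)
    then show ?thesis using odd_dec_odd_plus[of h a j] 4 assms by (simp add: algebra_simps)
  qed
qed

lemma odd_dec_snd_even:
  assumes "h \<ge> 4" "a = h + 2*j" "j \<ge> 1" "a \<le> 2*h"
  shows "odd_dec h (a + lift_rep (2*h+1) h (odd_snd h a)) = (False, 2*a)"
proof -
  consider "a = 2*h" | "a = 2*h-1" | "a = 2*h-2" | "a \<le> 2*h-3" using assms by linarith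
  then show ?thesis
  proof cases
    case 1 then have "even h" using assms by presburger
    with 1 assms(1) show ?thesis by (simp add: odd_dec_def odd_snd_def lift_rep_def)
  next
    case 2 then have "odd h" using assms by presburger
    with 2 assms(1) show ?thesis by (auto simp: odd_dec_def odd_snd_def lift_rep_def)
  next
    case 3
    with assms(1) show ?thesis by (simp add: odd_dec_def odd_snd_def lift_rep_def)
  next
    case 4
    then have "odd_snd h a = a + 3" "lift_rep (2*h+1) h (a+3) = a+3" using assms by (auto simp: odd_snd_def lift_rep_def)
    then show ?thesis using odd_dec_even_plus[of h a j] 4 assms by (simp add: algebra_simps)
  qed
qed

lemma odd_dec_snd_odd:
  assumes "h \<ge> 4" "a = h + 2*j+1" "j \<ge> 1" "a \<le> 2*h"
  shows "odd_dec h (a + lift_rep (2*h+1) h (odd_snd h a)) = (False, 2*a)"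
proof -
  consider "a = 2*h" | "a = 2*h-1" | "a = 2*h-2" | "a \<le> 2*h-3" using assms by linarith
  then show ?thesis
  proof cases
    case 1 then have "odd h" using assms by presburger
    with 1 assms(1) show ?thesis by (simp add: odd_dec_def odd_snd_def lift_rep_def)
  next
    case 2 then have "even h" using assms by presburger
    with 2 assms(1) show ?thesis by (simp add: odd_dec_def odd_snd_def lift_rep_def)
  next
    case 3
    with assms(1) show ?thesis by (simp add: odd_dec_def odd_snd_def lift_rep_def)
  next
    case 4
    then have "odd_snd h a = a - 1" "lift_rep (2*h+1) h (a-1) = a-1" using assms by (auto simp: odd_snd_def lift_rep_def)
    then show ?thesis using odd_dec_odd_minus[of h a j] 4 assms by (simp add: algebra_simps)
  qed
qed

lemma odd_dec_fst:
  assumes "h \<ge> 4" "1 \<le> a" "a \<le> 2*h"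
  shows "odd_dec h (a + lift_rep (2*h+1) h (odd_fst h a)) = (True, 2*a)"
proof (cases rule: around_cases[of a h])
  case 4 then show ?thesis using odd_dec_fst_even assms by blast
next
  case 5 then show ?thesis using odd_dec_fst_odd assms by blast
qed (use assms in \<open>auto simp: odd_fst_def odd_dec_def lift_rep_def split: if_splits; presburger\<close>)+

lemma odd_dec_snd:
  assumes "h \<ge> 4" "1 \<le> a" "a \<le> 2*h"
  shows "odd_dec h (a + lift_rep (2*h+1) h (odd_snd h a)) = (False, 2*a)"
proof (cases rule: around_cases[of a h])
  case 4 then show ?thesis using odd_dec_snd_even assms by blast
next
  case 5 then show ?thesis using odd_dec_snd_odd assms by blast
qed (use assms in \<open>auto simp: odd_snd_def odd_dec_def lift_rep_def split: if_splits; presburger\<close>)+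

definition odd_ret :: "int \<Rightarrow> bool \<Rightarrow> int \<Rightarrow> int" where
  "odd_ret h b c = (if b
     then if c < h \<or> c = h+1 \<or> c = 2*h then c else if c = h+3 then h
       else if odd (c-h) then c-2
       else if c = 2*h-1 then c else if c \<ge> 2*h-3 then c+1 else c+2
     else if c = 1 then 2*h-2 else if c < h then c-1 else if c = h then h
       else if c = h+1 then h-1 else if c = h+3 then h+1 else if odd (c-h) then c-3
       else if c = 2*h then c-1 else if c = 2*h-2 \<or> c = 2*h-3 then c+2 else c+1)"

lemma odd_ret_fst:
  assumes "h \<ge> 4" "1 \<le> a" "a \<le> 2*h"
  shows "odd_ret h True (odd_fst h a) = a"
proof -
  \<comment> \<open>The parity of \<open>h\<close> decides which of the top values have even offset
    from \<open>h\<close>.\<close>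
  consider k where "h = 2*k" | k where "h = 2*k + 1" by (metis evenE oddE)
  then show ?thesis
    by cases (cases rule: around_cases[of a h]; use assms in \<open>auto simp: odd_ret_def odd_fst_def split: if_splits; presburger\<close>)+
qed

lemma odd_ret_snd:
  assumes "h \<ge> 4" "1 \<le> a" "a \<le> 2*h"
  shows "odd_ret h False (odd_snd h a) = a"
proof -
  consider k where "h = 2*k" | k where "h = 2*k + 1" by (metis evenE oddE)
  then show ?thesis
    by cases (cases rule: around_cases[of a h]; use assms in \<open>auto simp: odd_ret_def odd_snd_def split: if_splits; presburger\<close>)+
qed

lemma odd_fst_range:
  assumes "h \<ge> 4" "1 \<le> a" "a \<le> 2*h"
  shows "1 \<le> odd_fst h a" "odd_fst h a \<le> 2*h"
    "a + lift_rep (2*h+1) h (odd_fst h a) \<in> {2..2*(2*h+1)+1} - {2*h+1, 2*(2*h+1)}"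
  using assms by (auto simp: odd_fst_def lift_rep_def split: if_splits; presburger)+

lemma odd_snd_range:
  assumes "h \<ge> 4" "1 \<le> a" "a \<le> 2*h"
  shows "1 \<le> odd_snd h a" "odd_snd h a \<le> 2*h"
    "a + lift_rep (2*h+1) h (odd_snd h a) \<in> {2..2*(2*h+1)+1} - {2*h+1, 2*(2*h+1)}"
  using assms by (auto simp: odd_snd_def lift_rep_def split: if_splits; presburger)+

lemma half_scheme_odd:
  assumes h: "h \<ge> 4"
  shows "half_scheme (2*h+1) h (\<lambda>b. if b then odd_fst h else odd_snd h)"
proof (rule half_schemeI[where dec = "odd_dec h" and ret = "odd_ret h"])
  fix b r assume "r \<in> {1..<2*h+1}"
  then have r: "1 \<le> r" "r \<le> 2*h" by auto
  show "(if b then odd_fst h else odd_snd h) r \<in> {1..<2*h+1}"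
    using odd_fst_range[OF h r] odd_snd_range[OF h r] by auto
  show "r + lift_rep (2*h+1) h ((if b then odd_fst h else odd_snd h) r) \<in> {2..2*(2*h+1)+1} - {2*h+1, 2*(2*h+1)}"
    using odd_fst_range(3)[OF h r] odd_snd_range(3)[OF h r] by (cases b) auto
  show "odd_dec h (r + lift_rep (2*h+1) h ((if b then odd_fst h else odd_snd h) r)) = (b, 2*r)"
    using odd_dec_fst[OF h r] odd_dec_snd[OF h r] by auto
  show "odd_ret h b ((if b then odd_fst h else odd_snd h) r) = r"
    using odd_ret_fst[OF h r] odd_ret_snd[OF h r] by (cases b) auto
qed (use h in simp)

text \<open>For \<open>t = 5\<close>, multiplication by 1 and by 3 is already a solution; for
  \<open>t = 7\<close>, by 1 and by 2. The finitely many sums are checked by enumeration.\<close>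

lemma half_scheme_5: "half_scheme 5 2 (\<lambda>b r. if b then r else (3 * r) mod 5)"
proof -
  have "{1..<5} = {1, 2, 3, 4 :: int}" by auto
  then show ?thesis by (simp add: half_scheme_def half_sum_def lift_rep_def inj_on_def UNIV_bool)
qed

lemma half_scheme_7: "half_scheme 7 3 (\<lambda>b r. if b then r else (2 * r) mod 7)"
proof -
  have "{1..<7} = {1, 2, 3, 4, 5, 6 :: int}" by auto
  then show ?thesis by (simp add: half_scheme_def half_sum_def lift_rep_def inj_on_def UNIV_bool)
qed

lemma ex_half_scheme:
  assumes "t \<ge> (4 :: int)"
  shows "\<exists>h \<sigma>. half_scheme t h \<sigma>"
proof -
  obtain h where "t = 2*h \<or> t = 2*h + 1" by (metis evenE oddE)
  \<comment> \<open>In the odd case \<open>t \<ge> 4\<close> gives \<open>h \<ge> 2\<close>, and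
    \<open>h = 2\<close>, \<open>h = 3\<close> are the small cases.\<close>
  with assms consider "t = 2*h" "h \<ge> 2" | "t = 5" | "t = 7" | "t = 2*h + 1" "h \<ge> 4"
    by force
  then show ?thesis
    by cases (use half_scheme_even half_scheme_5 half_scheme_7 half_scheme_odd in blast)+
qed

section \<open>Existence of both designs through holey orthomorphisms\<close>

theorem theorem1p6:
  fixes m t :: nat
  assumes "m > 0" and "t > 0"
  shows "((\<exists>\<B>. is_SCHGDD 3 3 m t \<B>) \<longleftrightarrow> (\<exists>D. is_CHDM 3 m t D)) \<and>
    ((\<exists>\<B>. is_SCHGDD 3 3 m t \<B>) \<longleftrightarrow>
       [(t - 1) * m = 0] (mod 2) \<and> t \<ge> 3 \<and> \<not> ([m = 0] (mod 2) \<and> t = 3))"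
proof -
  \<comment> \<open>For \<open>t = 1\<close> every \<open>f\<close> is vacuously a holey
    orthomorphism; \<open>t \<ge> 2\<close> reflects that designs are nonempty.\<close>
  have S: "(\<exists>\<B>. is_SCHGDD 3 3 m t \<B>) \<longleftrightarrow> t \<ge> 2 \<and> (\<exists>f. holey_orthomorphism m t f)"
    using holey_orthomorphism_of_SCHGDD[OF _ assms] SCHGDD_of_holey_orthomorphism[OF _ assms(1)] by blast
  have C: "(\<exists>D. is_CHDM 3 m t D) \<longleftrightarrow> t \<ge> 2 \<and> (\<exists>f. holey_orthomorphism m t f)"
    using holey_orthomorphism_of_CHDM[OF _ assms] CHDM_of_holey_orthomorphism[OF _ assms(1)] by blast
  have "t \<ge> 2 \<and> (\<exists>f. holey_orthomorphism m t f) \<longleftrightarrow>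
      even ((t - 1) * m) \<and> t \<ge> 3 \<and> \<not> (even m \<and> t = 3)"
  proof
    assume "t \<ge> 2 \<and> (\<exists>f. holey_orthomorphism m t f)"
    then obtain f where f: "t \<ge> 2" "holey_orthomorphism m t f" by blast
    have "t \<noteq> 2" using no_holey_orthomorphism_2[OF _ assms(1)] f(2) by blast
    moreover have "odd m" if "t = 3"
      using odd_of_holey_orthomorphism_3[OF _ assms(1)] f(2) that by blast
    moreover have "even ((t - 1) * m)" by (rule even_card_of_holey_orthomorphism[OF f(2) assms])
    ultimately show "even ((t - 1) * m) \<and> t \<ge> 3 \<and> \<not> (even m \<and> t = 3)" using f(1) by auto
  next
    assume cond: "even ((t - 1) * m) \<and> t \<ge> 3 \<and> \<not> (even m \<and> t = 3)"
    have "\<exists>f. holey_orthomorphism m t f"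
    proof (cases "even m")
      case True
      then obtain n where n: "m = 2 * n" by blast
      have "int t \<ge> 4" using cond True by auto
      then obtain h \<sigma> where "half_scheme (int t) h \<sigma>" using ex_half_scheme by blast
      then show ?thesis using holey_orthomorphism_of_half_scheme[of t h \<sigma> n] n assms by simp
    next
      case False
      \<comment> \<open>For odd \<open>m\<close>, evenness of \<open>(t - 1) * m\<close> makes
        \<open>t\<close> odd.\<close>
      then have "odd (m * t)" using cond by auto
      then show ?thesis using holey_orthomorphism_double by blast
    qed
    then show "t \<ge> 2 \<and> (\<exists>f. holey_orthomorphism m t f)" using cond by simp
  qed
  then show ?thesis unfolding S C by (simp add: cong_0_iff)
qed

end
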